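(* Let $T$ be a subcubic tree of order $n$ and independence number $\alpha=\frac{n}{2}$. Then $$\sharp\alpha(T)\leq f(\alpha+2).$$ Furthermore, equality holds in this inequality if and only if $T$ is (isomorphic to) $T(\alpha)$.
   Context: All graphs are finite, simple, and undirected. The order of a graph is its number of vertices. A graph is subcubic if its maximum degree is at most $3$. The independence number of a graph is the maximum cardinality of a set of pairwise non-adjacent vertices (an independent set). An independent set is maximum if its cardinality equals the independence number, and $\sharp\alpha(G)$ denotes the number of maximum independent sets in a graph $G$. $f(m)$ denotes the $m$-th Fibonacci number: $f(0)=0$, $f(1)=1$, and $f(m)=f(m-1)+f(m-2)$ for $m\geq 2$. For a positive integer $k$, $T(k)$ is the tree that arises from a path of order $k$ by attaching one new endvertex (vertex of degree $1$) to every vertex of the path; it has order $2k$. *)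

theory Defs
  imports "Graph_Theory.Graph_Theory" "HOL-Number_Theory.Fib"
begin

text \<open>
  A finite simple undirected graph is a \<^locale>\<open>pair_graph\<close>: a finite vertex set together with a
  symmetric irreflexive adjacency relation on it.
\<close>

text \<open>
  The constants \<^const>\<open>forest\<close> and \<^const>\<open>tree\<close> of the library are not usable for undirected
  graphs: in a symmetric digraph every edge yields a \<^const>\<open>pre_digraph.cycle\<close> of length 2.
  Cycles of an undirected graph are exactly those of length at least 3.  Note that
  \<^const>\<open>connected\<close> excludes the null graph.
\<close>

definition undirected_tree :: "'a pair_pre_digraph \<Rightarrow> bool" where
  "undirected_tree G \<longleftrightarrow> pair_graph G \<and> connected (with_proj G) \<and>
     \<not> (\<exists>p. pre_digraph.cycle (with_proj G) p \<and> 3 \<le> length p)"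

text \<open>
  In a symmetric digraph without parallel arcs, the out-degree of a vertex is its number of
  neighbours.  The value of \<open>max_degree\<close> on the null graph is unspecified.
\<close>

definition max_degree :: "'a pair_pre_digraph \<Rightarrow> nat" where
  "max_degree G = Max (out_degree (with_proj G) ` pverts G)"

definition subcubic :: "'a pair_pre_digraph \<Rightarrow> bool" where
  "subcubic G \<longleftrightarrow> max_degree G \<le> 3"

definition independent_set :: "'a pair_pre_digraph \<Rightarrow> 'a set \<Rightarrow> bool" where
  "independent_set G S \<longleftrightarrow> S \<subseteq> pverts G \<and> (\<forall>u\<in>S. \<forall>v\<in>S. u \<noteq> v \<longrightarrow> (u, v) \<notin> parcs G)"

definition independence_number :: "'a pair_pre_digraph \<Rightarrow> nat" where
  "independence_number G = Max (card ` {S. independent_set G S})"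

definition num_max_independent_sets :: "'a pair_pre_digraph \<Rightarrow> nat" where
  "num_max_independent_sets G = card {S. independent_set G S \<and> card S = independence_number G}"

text \<open>
  The tree \<open>T(k)\<close>: the vertices \<open>(i, False)\<close> for \<open>i < k\<close> form the path, in this order, and
  \<open>(i, True)\<close> is the endvertex attached to \<open>(i, False)\<close>.
\<close>

definition T_graph :: "nat \<Rightarrow> (nat \<times> bool) pair_pre_digraph" where
  "T_graph k = (let A = {((i, False), (Suc i, False)) | i. Suc i < k} \<union>
                        {((i, False), (i, True)) | i. i < k}
                in \<lparr> pverts = {..<k} \<times> UNIV, parcs = A \<union> A\<inverse> \<rparr>)"

lemma pair_graph_T_graph: "pair_graph (T_graph k)"
proof
  have "parcs (T_graph k) \<subseteq> pverts (T_graph k) \<times> pverts (T_graph k)"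
    by (auto simp: T_graph_def Let_def)
  moreover show "finite (pverts (T_graph k))"
    by (auto simp: T_graph_def Let_def)
  ultimately show "finite (parcs (T_graph k))"
    using finite_subset by blast
qed (auto simp: T_graph_def Let_def symmetric_def sym_def)

lemma card_pverts_T_graph: "card (pverts (T_graph k)) = 2 * k"
  by (simp add: T_graph_def Let_def card_cartesian_product)

end

theory Submission
  imports Defs
begin

text \<open>
  If \<open>n = 2 \<alpha>\<close>, then \<open>T\<close> has a perfect matching and a maximum independent set picks exactly one end of
  each matching edge.  Root \<open>T\<close> at a leaf.  A branch that contains \<open>k\<close> matching edges has at most
  \<open>fib (k + 2)\<close> such sets, and at most \<open>fib (k + 1)\<close> of them avoid its root: if the root \<open>a\<close> is matched
  with \<open>b\<close>, then \<open>a\<close> carries at most one further branch \<open>c\<close> and \<open>b\<close> at most two, \<open>d\<close> and \<open>e\<close>, so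
  with totals \<open>S\<close> and root-avoiding counts \<open>B\<close> the sets containing \<open>a\<close> number \<open>B c * S d * S e\<close> and
  the others \<open>S c * B d * B e\<close>.  Both bounds are attained together only if \<open>d\<close> and \<open>e\<close> are empty
  at every level, which makes the branch a comb; at the root, where \<open>c\<close> is empty, equality
  glues the combs \<open>d\<close> and \<open>e\<close> at \<open>b\<close> to a longer comb.
\<close>

section \<open>Counting in trees with a perfect matching\<close>

text \<open>
  A tree with a perfect matching, rooted at \<open>a\<close>: in \<open>Node a b c d e\<close> the root is matched with \<open>b\<close>, the
  subtree \<open>c\<close> hangs off \<open>a\<close>, and \<open>d\<close>, \<open>e\<close> hang off \<open>b\<close>.  Three slots suffice when every degree is at
  most 3 and \<open>a\<close> is either a leaf or joined to a parent.
\<close>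

datatype 'a ptree = Tip | Node 'a 'a "'a ptree" "'a ptree" "'a ptree"

fun join :: "'a \<Rightarrow> 'a ptree \<Rightarrow> 'a rel" where
  "join x Tip = {}"
| "join x (Node a b c d e) = {(x, a), (a, x)}"

primrec tverts :: "'a ptree \<Rightarrow> 'a set" where
  "tverts Tip = {}"
| "tverts (Node a b c d e) = {a, b} \<union> tverts c \<union> tverts d \<union> tverts e"

primrec tarcs :: "'a ptree \<Rightarrow> 'a rel" where
  "tarcs Tip = {}"
| "tarcs (Node a b c d e) = {(a, b), (b, a)} \<union> join a c \<union> join b d \<union> join b e
     \<union> tarcs c \<union> tarcs d \<union> tarcs e"

primrec tsize :: "'a ptree \<Rightarrow> nat" where
  "tsize Tip = 0"
| "tsize (Node a b c d e) = Suc (tsize c + tsize d + tsize e)"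

primrec wf_ptree :: "'a ptree \<Rightarrow> bool" where
  "wf_ptree Tip = True"
| "wf_ptree (Node a b c d e) \<longleftrightarrow> wf_ptree c \<and> wf_ptree d \<and> wf_ptree e \<and> a \<noteq> b \<and>
     a \<notin> tverts c \<union> tverts d \<union> tverts e \<and> b \<notin> tverts c \<union> tverts d \<union> tverts e \<and>
     tverts c \<inter> tverts d = {} \<and> tverts c \<inter> tverts e = {} \<and> tverts d \<inter> tverts e = {}"

fun root_in :: "'a ptree \<Rightarrow> 'a set \<Rightarrow> bool" where
  "root_in Tip I = False"
| "root_in (Node a b c d e) I = (a \<in> I)"

text \<open>The case \<open>u = v\<close> is not excluded, unlike in \<open>independent_set\<close>.
  On a loop-free graph the edge conditions agree, and no inequality has to be carried along.\<close>

definition indep :: "'a rel \<Rightarrow> 'a set \<Rightarrow> bool" where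
  "indep D I \<longleftrightarrow> (\<forall>u\<in>I. \<forall>v\<in>I. (u, v) \<notin> D)"

text \<open>
  The independent sets with one vertex in each matching edge; the flag tells whether the root
  belongs to the set.
\<close>

primrec mis :: "'a ptree \<Rightarrow> bool \<Rightarrow> 'a set set" where
  "mis Tip \<beta> = (if \<beta> then {} else {{}})"
| "mis (Node a b c d e) \<beta> =
    (if \<beta> then (\<lambda>(x, y, z). insert a (x \<union> y \<union> z)) `
         (mis c False \<times> (mis d False \<union> mis d True) \<times> (mis e False \<union> mis e True))
     else (\<lambda>(x, y, z). insert b (x \<union> y \<union> z)) `
         ((mis c False \<union> mis c True) \<times> mis d False \<times> mis e False))"

lemma finite_tverts [simp]: "finite (tverts t)"
  by (induction t) auto

lemma join_verts: "(u, v) \<in> join x t \<Longrightarrow> u \<in> insert x (tverts t) \<and> v \<in> insert x (tverts t)"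
  by (cases t) auto

lemma tarcs_verts: "(u, v) \<in> tarcs t \<Longrightarrow> u \<in> tverts t \<and> v \<in> tverts t"
  by (induction t) (auto dest!: join_verts)

lemma tarcs_subset: "tarcs t \<subseteq> tverts t \<times> tverts t"
  using tarcs_verts by (metis SigmaI subrelI)

lemma card_tverts: "wf_ptree t \<Longrightarrow> card (tverts t) = 2 * tsize t"
  by (induction t) (auto simp: card_Un_disjoint Int_Un_distrib2)

lemma root_in_Int: "root_in t (I \<inter> tverts t) = root_in t I"
  by (cases t) auto

lemma indep_join:
  "indep (join x t) I \<longleftrightarrow> \<not> (x \<in> I \<and> root_in t I)"
  by (cases t) (auto simp: indep_def)

lemma indep_Un: "indep (D \<union> E) I \<longleftrightarrow> indep D I \<and> indep E I"
  by (auto simp: indep_def)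

lemma indep_Int: "D \<subseteq> V \<times> V \<Longrightarrow> indep D (I \<inter> V) \<longleftrightarrow> indep D I"
  by (auto simp: indep_def)

lemma indep_Node:
  "indep (tarcs (Node a b c d e)) I \<longleftrightarrow> \<not> (a \<in> I \<and> b \<in> I) \<and>
     \<not> (a \<in> I \<and> root_in c I) \<and> \<not> (b \<in> I \<and> root_in d I) \<and> \<not> (b \<in> I \<and> root_in e I) \<and>
     indep (tarcs c) I \<and> indep (tarcs d) I \<and> indep (tarcs e) I"
proof -
  have "indep {(a, b), (b, a)} I \<longleftrightarrow> \<not> (a \<in> I \<and> b \<in> I)"
    by (auto simp: indep_def)
  then show ?thesis
    by (simp only: tarcs.simps indep_Un indep_join) blast
qed

text \<open>A member of \<open>mis\<close> has one vertex in each matching edge, hence size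
  \<open>tsize t\<close>. Its parts lie in disjoint branches, so each restriction to a branch is the
  part chosen there, and the induction hypothesis applies to it.\<close>

lemma mis_properties:
  assumes "wf_ptree t" "I \<in> mis t \<beta>"
  shows "I \<subseteq> tverts t \<and> indep (tarcs t) I \<and> card I = tsize t \<and> root_in t I = \<beta>"
  using assms
proof (induction t arbitrary: I \<beta>)
  case Tip
  then show ?case by (auto simp: indep_def split: if_splits)
next
  case (Node a b c d e)
  \<comment> \<open>One shape for both cases: \<open>\<beta>c\<close>, \<open>\<beta>d\<close>,
    \<open>\<beta>e\<close> record whether each part contains its branch root. Only the branches
    hanging off the chosen end must avoid theirs.\<close>
  obtain x y z \<beta>c \<beta>d \<beta>e where I: "I = insert (if \<beta> then a else b) (x \<union> y \<union> z)"
    and xyz: "x \<in> mis c \<beta>c" "y \<in> mis d \<beta>d" "z \<in> mis e \<beta>e"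
    and \<beta>: "if \<beta> then \<not> \<beta>c else \<not> \<beta>d \<and> \<not> \<beta>e"
  proof (cases \<beta>)
    case True
    then obtain w where w: "w \<in> mis c False \<times> (mis d False \<union> mis d True) \<times> (mis e False \<union> mis e True)"
      "I = (\<lambda>(x, y, z). insert a (x \<union> y \<union> z)) w"
      using Node.prems(2) unfolding mis.simps if_P[OF True] by (elim imageE) simp
    obtain x y z where "w = (x, y, z)" by (cases w)
    with w have "I = insert a (x \<union> y \<union> z)" "x \<in> mis c False"
      "y \<in> mis d False \<union> mis d True" "z \<in> mis e False \<union> mis e True" by simp_all
    moreover from this obtain \<beta>d \<beta>e where "y \<in> mis d \<beta>d" "z \<in> mis e \<beta>e" by blast
    ultimately show thesis using True that[of x y z False \<beta>d \<beta>e] by simp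
  next
    case False
    then obtain w where w: "w \<in> (mis c False \<union> mis c True) \<times> mis d False \<times> mis e False"
      "I = (\<lambda>(x, y, z). insert b (x \<union> y \<union> z)) w"
      using Node.prems(2) unfolding mis.simps if_not_P[OF False] by (elim imageE) simp
    obtain x y z where "w = (x, y, z)" by (cases w)
    with w have "I = insert b (x \<union> y \<union> z)" "x \<in> mis c False \<union> mis c True"
      "y \<in> mis d False" "z \<in> mis e False" by simp_all
    moreover from this obtain \<beta>c where "x \<in> mis c \<beta>c" by blast
    ultimately show thesis using False that[of x y z \<beta>c False False] by simp
  qed
  have wf_ptree: "wf_ptree c" "wf_ptree d" "wf_ptree e" using Node.prems(1) by auto
  have x: "x \<subseteq> tverts c" "indep (tarcs c) x" "card x = tsize c" "root_in c x = \<beta>c"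
    using Node.IH(1)[OF wf_ptree(1) xyz(1)] by auto
  have y: "y \<subseteq> tverts d" "indep (tarcs d) y" "card y = tsize d" "root_in d y = \<beta>d"
    using Node.IH(2)[OF wf_ptree(2) xyz(2)] by auto
  have z: "z \<subseteq> tverts e" "indep (tarcs e) z" "card z = tsize e" "root_in e z = \<beta>e"
    using Node.IH(3)[OF wf_ptree(3) xyz(3)] by auto
  have fin: "finite x" "finite y" "finite z"
    using x(1) y(1) z(1) finite_tverts finite_subset by metis+
  have int: "I \<inter> tverts c = x" "I \<inter> tverts d = y" "I \<inter> tverts e = z"
    using x(1) y(1) z(1) Node.prems(1) I by auto
  have card: "card I = tsize (Node a b c d e)"
  proof -
    have "card (x \<union> y \<union> z) = tsize c + tsize d + tsize e"
    proof -
      have "x \<inter> y = {}" "(x \<union> y) \<inter> z = {}"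
        using x(1) y(1) z(1) Node.prems(1) by auto
      then show ?thesis using fin x(3) y(3) z(3) by (simp add: card_Un_disjoint)
    qed
    moreover have "(if \<beta> then a else b) \<notin> x \<union> y \<union> z"
      using x(1) y(1) z(1) Node.prems(1) by auto
    ultimately show ?thesis using fin I by simp
  qed
  have ind: "indep (tarcs c) I" "indep (tarcs d) I" "indep (tarcs e) I"
    using int x(2) y(2) z(2) indep_Int[OF tarcs_subset] by metis+
  have rts: "root_in c I = \<beta>c" "root_in d I = \<beta>d" "root_in e I = \<beta>e"
    using int x(4) y(4) z(4) root_in_Int by metis+
  have ab: "a \<in> I \<longleftrightarrow> \<beta>" "b \<in> I \<longleftrightarrow> \<not> \<beta>"
    using x(1) y(1) z(1) Node.prems(1) I by auto
  have "indep (tarcs (Node a b c d e)) I"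
    using ind rts ab \<beta> by (auto simp only: indep_Node split: if_splits)
  moreover have "I \<subseteq> tverts (Node a b c d e)" using I x(1) y(1) z(1) by auto
  ultimately show ?case using card ab by simp
qed

text \<open>Converse to \<open>mis_properties\<close>: an independent set meets each matching edge
  at most once, and equality in the bound forces equality in every branch and a vertex in the top
  edge.\<close>

lemma indep_card_le:
  assumes "wf_ptree t" "I \<subseteq> tverts t" "indep (tarcs t) I"
  shows "card I \<le> tsize t \<and> (card I = tsize t \<longrightarrow> I \<in> mis t (root_in t I))"
  using assms
proof (induction t arbitrary: I)
  case Tip
  then show ?case by auto
next
  case (Node a b c d e)
  have wf_ptree: "wf_ptree c" "wf_ptree d" "wf_ptree e" using Node.prems(1) by auto
  let ?x = "I \<inter> tverts c" and ?y = "I \<inter> tverts d" and ?z = "I \<inter> tverts e"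
  note ind = Node.prems(3)[unfolded indep_Node]
  have x: "card ?x \<le> tsize c" "card ?x = tsize c \<Longrightarrow> ?x \<in> mis c (root_in c I)"
    using Node.IH(1)[OF wf_ptree(1), of ?x] ind indep_Int[OF tarcs_subset, of c I] root_in_Int[of c I] by auto
  have y: "card ?y \<le> tsize d" "card ?y = tsize d \<Longrightarrow> ?y \<in> mis d (root_in d I)"
    using Node.IH(2)[OF wf_ptree(2), of ?y] ind indep_Int[OF tarcs_subset, of d I] root_in_Int[of d I] by auto
  have z: "card ?z \<le> tsize e" "card ?z = tsize e \<Longrightarrow> ?z \<in> mis e (root_in e I)"
    using Node.IH(3)[OF wf_ptree(3), of ?z] ind indep_Int[OF tarcs_subset, of e I] root_in_Int[of e I] by auto
  have cU: "card (?x \<union> ?y \<union> ?z) = card ?x + card ?y + card ?z"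
  proof -
    have "?x \<inter> ?y = {}" "(?x \<union> ?y) \<inter> ?z = {}" using Node.prems(1) by auto
    then show ?thesis by (simp add: card_Un_disjoint)
  qed
  have mem: "S \<in> mis t False \<union> mis t True" if "S \<in> mis t \<beta>" for S \<beta> and t :: "'a ptree"
    using that by (cases \<beta>) auto
  consider "a \<in> I" "b \<notin> I" | "a \<notin> I" "b \<in> I" | "a \<notin> I" "b \<notin> I" using ind by blast
  then show ?case
  proof cases
    case 1
    then have I: "I = insert a (?x \<union> ?y \<union> ?z)" using Node.prems(2) by auto
    have "card I = Suc (card (?x \<union> ?y \<union> ?z))"
      by (subst I, subst card_insert_disjoint) (use Node.prems(1) in auto)
    then have c: "card I = Suc (card ?x + card ?y + card ?z)" using cU by simp
    have "I \<in> mis (Node a b c d e) True" if "card I = tsize (Node a b c d e)"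
    proof -
      have "card ?x = tsize c" "card ?y = tsize d" "card ?z = tsize e"
        using that c x(1) y(1) z(1) by auto
      then have "?x \<in> mis c False" "?y \<in> mis d False \<union> mis d True" "?z \<in> mis e False \<union> mis e True"
        using x(2) y(2) z(2) ind 1 mem by metis+
      then have "(?x, ?y, ?z) \<in> mis c False \<times> (mis d False \<union> mis d True) \<times> (mis e False \<union> mis e True)"
        by blast
      from imageI[OF this, of "\<lambda>(x, y, z). insert a (x \<union> y \<union> z)"] show ?thesis using I by simp
    qed
    then show ?thesis using c x(1) y(1) z(1) 1 by simp
  next
    case 2
    then have I: "I = insert b (?x \<union> ?y \<union> ?z)" using Node.prems(2) by auto
    have "card I = Suc (card (?x \<union> ?y \<union> ?z))"
      by (subst I, subst card_insert_disjoint) (use Node.prems(1) in auto)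
    then have c: "card I = Suc (card ?x + card ?y + card ?z)" using cU by simp
    have "I \<in> mis (Node a b c d e) False" if "card I = tsize (Node a b c d e)"
    proof -
      have "card ?x = tsize c" "card ?y = tsize d" "card ?z = tsize e"
        using that c x(1) y(1) z(1) by auto
      then have "?x \<in> mis c False \<union> mis c True" "?y \<in> mis d False" "?z \<in> mis e False"
        using x(2) y(2) z(2) ind 2 mem by metis+
      then have "(?x, ?y, ?z) \<in> (mis c False \<union> mis c True) \<times> mis d False \<times> mis e False"
        by blast
      from imageI[OF this, of "\<lambda>(x, y, z). insert b (x \<union> y \<union> z)"] show ?thesis using I by simp
    qed
    then show ?thesis using c x(1) y(1) z(1) 2 by simp
  next
    \<comment> \<open>Missing both ends of the top edge costs one vertex, so the size
      \<open>tsize\<close> is out of reach.\<close>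
    case 3
    then have I: "I = ?x \<union> ?y \<union> ?z" using Node.prems(2) by auto
    have "card I = card ?x + card ?y + card ?z" using cU I by simp
    then show ?thesis using x(1) y(1) z(1) by simp
  qed
qed

section \<open>Cardinalities and Fibonacci bounds\<close>

definition tcount :: "'a ptree \<Rightarrow> nat" where
  "tcount t = card (mis t False \<union> mis t True)"

lemma finite_mis [simp]: "finite (mis t \<beta>)"
  by (induction t arbitrary: \<beta>) auto

lemma tcount_Tip [simp]: "tcount Tip = 1"
  by (simp add: tcount_def)

text \<open>Intersecting with the vertex sets of the branches undoes the union. The product is the
  largest one, so that both cases of \<open>mis\<close> inherit injectivity by restriction.\<close>

lemma inj_on_mis:
  assumes "wf_ptree (Node a b c d e)" "p = a \<or> p = b"
  shows "inj_on (\<lambda>(x, y, z). insert p (x \<union> y \<union> z))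
     ((mis c False \<union> mis c True) \<times> (mis d False \<union> mis d True) \<times> (mis e False \<union> mis e True))"
    (is "inj_on ?f ?X")
proof (rule inj_on_inverseI[where g = "\<lambda>I. (I \<inter> tverts c, I \<inter> tverts d, I \<inter> tverts e)"])
  fix w assume "w \<in> ?X"
  then obtain x y z where w: "w = (x, y, z)" "x \<subseteq> tverts c" "y \<subseteq> tverts d" "z \<subseteq> tverts e"
    using mis_properties assms(1) by (auto dest!: mis_properties[rotated])
  then show "(?f w \<inter> tverts c, ?f w \<inter> tverts d, ?f w \<inter> tverts e) = w"
    using assms by auto
qed

lemma card_mis_True:
  assumes "wf_ptree (Node a b c d e)"
  shows "card (mis (Node a b c d e) True) = card (mis c False) * tcount d * tcount e"
  using card_image[OF inj_on_subset[OF inj_on_mis[OF assms, of a]],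
      of "mis c False \<times> (mis d False \<union> mis d True) \<times> (mis e False \<union> mis e True)"]
  by (simp add: card_cartesian_product tcount_def Sigma_mono mult.assoc)

lemma card_mis_False:
  assumes "wf_ptree (Node a b c d e)"
  shows "card (mis (Node a b c d e) False) = tcount c * card (mis d False) * card (mis e False)"
  using card_image[OF inj_on_subset[OF inj_on_mis[OF assms, of b]],
      of "(mis c False \<union> mis c True) \<times> mis d False \<times> mis e False"]
  by (simp add: card_cartesian_product tcount_def Sigma_mono mult.assoc)

lemma tcount_Node:
  assumes "wf_ptree (Node a b c d e)"
  shows "tcount (Node a b c d e) = card (mis c False) * tcount d * tcount e
    + tcount c * card (mis d False) * card (mis e False)"
proof -
  have "mis (Node a b c d e) False \<inter> mis (Node a b c d e) True = {}"
    using mis_properties[OF assms, of _ False] mis_properties[OF assms, of _ True] by blast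
  then have "tcount (Node a b c d e) = card (mis (Node a b c d e) False) + card (mis (Node a b c d e) True)"
    unfolding tcount_def by (intro card_Un_disjoint) (simp_all only: finite_mis)
  then show ?thesis using card_mis_True[OF assms] card_mis_False[OF assms] by simp
qed

lemma fib_mult_le: "fib (Suc m) * fib (Suc n) \<le> fib (Suc (m + n))"
  by (simp add: fib_add mult.commute)

text \<open>
  The summand with the factor \<open>fib c\<close> is the slack in the bound; it vanishes if \<open>c = 0\<close>, which is
  the case at the root of the whole tree, or if \<open>d = e = 0\<close>.
\<close>

lemma fib_branch:
  "fib (Suc c) * fib (d + 2) * fib (e + 2) + fib (c + 2) * fib (Suc d) * fib (Suc e)
     + fib c * (fib (Suc d) * fib e + fib d * fib (Suc e)) = fib (c + d + e + 3)"
proof -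
  have "fib (c + d + e + 3) = fib (Suc (c + Suc (Suc (d + e))))"
    by (rule arg_cong[where f = fib]) simp
  also have "\<dots> = fib (Suc (Suc (Suc (d + e)))) * fib (Suc c) + fib (Suc (Suc (d + e))) * fib c"
    by (rule fib_add)
  also have "fib (Suc (Suc (Suc (d + e)))) = 2 * fib (Suc (d + e)) + fib (d + e)" by simp
  also have "fib (Suc (Suc (d + e))) = fib (Suc (d + e)) + fib (d + e)" by simp
  finally have 1: "fib (c + d + e + 3) = (2 * fib (Suc (d + e)) + fib (d + e)) * fib (Suc c)
     + (fib (Suc (d + e)) + fib (d + e)) * fib c" .
  have 2: "fib (Suc (d + e)) = fib (Suc e) * fib (Suc d) + fib e * fib d" by (rule fib_add)
  \<comment> \<open>This trades \<open>fib (d + e)\<close> for the mixed products in the claim. The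
    addition formula needs a successor, so \<open>d = 0\<close> is separate.\<close>
  have 3: "fib (d + e) + fib e * fib d = fib (Suc d) * fib e + fib d * fib (Suc e)"
  proof (cases d)
    case (Suc d')
    then show ?thesis using fib_add[of d' e] by (simp add: algebra_simps)
  qed simp
  let ?A = "fib (Suc d) * fib e" and ?B = "fib d * fib (Suc e)" and ?C = "fib e * fib d"
  let ?D = "fib (Suc d) * fib (Suc e)"
  have "fib (c + d + e + 3) = (2 * ?D + 2 * ?C + fib (d + e)) * fib (Suc c) + (?D + ?C + fib (d + e)) * fib c"
    using 1 2 by (simp add: algebra_simps)
  also have "2 * ?D + 2 * ?C + fib (d + e) = 2 * ?D + ?C + ?A + ?B" using 3 by linarith
  also have "?D + ?C + fib (d + e) = ?D + ?A + ?B" using 3 by linarith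
  finally show ?thesis by (simp add: algebra_simps)
qed

fun chain :: "('a \<times> 'a) list \<Rightarrow> 'a ptree" where
  "chain [] = Tip"
| "chain ((a, b) # xs) = Node a b (chain xs) Tip Tip"

lemma tsize_eq_0 [simp]: "tsize t = 0 \<longleftrightarrow> t = Tip"
  by (cases t) auto

text \<open>The two bounds are proved together since the counting formulas mix both quantities. The
  equality clause assumes both attained: either one alone also holds for trees that are not
  chains.\<close>

lemma tcount_bound:
  assumes "wf_ptree t"
  shows "card (mis t False) \<le> fib (Suc (tsize t)) \<and> tcount t \<le> fib (tsize t + 2) \<and>
    (card (mis t False) = fib (Suc (tsize t)) \<and> tcount t = fib (tsize t + 2) \<longrightarrow> (\<exists>L. t = chain L))"
  using assms
proof (induction t)
  case Tip
  have "Tip = chain []" by simp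
  then show ?case unfolding tcount_Tip by (auto simp: numeral_2_eq_2 intro: exI[of _ "[]"])
next
  case (Node a b c d e)
  let ?t = "Node a b c d e" and ?c = "tsize c" and ?d = "tsize d" and ?e = "tsize e"
  have B: "card (mis c False) \<le> fib (Suc ?c)" "card (mis d False) \<le> fib (Suc ?d)"
      "card (mis e False) \<le> fib (Suc ?e)"
    and S: "tcount c \<le> fib (?c + 2)" "tcount d \<le> fib (?d + 2)" "tcount e \<le> fib (?e + 2)"
    using Node by auto
  have "tcount ?t \<le> fib (Suc ?c) * fib (?d + 2) * fib (?e + 2) + fib (?c + 2) * fib (Suc ?d) * fib (Suc ?e)"
    unfolding tcount_Node[OF Node.prems] using B S by (intro add_mono mult_mono) auto
  also have "\<dots> \<le> fib (?c + ?d + ?e + 3)"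
    using fib_branch[of ?c ?d ?e] by linarith
  finally have le2: "tcount ?t \<le> fib (tsize ?t + 2)" by (simp add: numeral_eq_Suc)
  have BdBe: "card (mis d False) * card (mis e False) \<le> fib (Suc (?d + ?e))"
    using mult_mono[OF B(2,3)] fib_mult_le[of ?d ?e] by linarith
  have SBB: "tcount c * card (mis d False) * card (mis e False) \<le> fib (?c + 2) * fib (Suc (?d + ?e))"
    using mult_mono[OF S(1) BdBe] by (simp add: mult.assoc)
  \<comment> \<open>The bound exceeds the estimate \<open>SBB\<close> by
    \<open>fib (Suc ?c) * fib (?d + ?e)\<close>, a slack that is zero only for
    \<open>?d + ?e = 0\<close>; equality therefore empties both slots.\<close>
  have split: "fib (Suc (tsize ?t)) = fib (?c + 2) * fib (Suc (?d + ?e)) + fib (Suc ?c) * fib (?d + ?e)"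
    using fib_add[of "?d + ?e" "Suc ?c"] by (simp add: ac_simps)
  have le1: "card (mis ?t False) \<le> fib (Suc (tsize ?t))"
    unfolding card_mis_False[OF Node.prems] split using SBB by linarith
  moreover have "\<exists>L. ?t = chain L"
    if eq: "card (mis ?t False) = fib (Suc (tsize ?t))" "tcount ?t = fib (tsize ?t + 2)"
  proof -
    have "fib (Suc ?c) * fib (?d + ?e) = 0"
      using eq(1) SBB unfolding card_mis_False[OF Node.prems] split by linarith
    then have "fib (?d + ?e) = 0"
      using fib_neq_0_nat[of "Suc ?c"] by (simp del: fib.simps)
    then have "?d + ?e = 0"
      using fib_neq_0_nat[of "?d + ?e"] by (cases "?d + ?e") auto
    then have de: "d = Tip" "e = Tip" by simp_all
    \<comment> \<open>With \<open>d\<close> and \<open>e\<close> empty, avoiding \<open>a\<close>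
      leaves \<open>c\<close> unrestricted, so its total is extremal. Subtracting this from the
      total for \<open>?t\<close> makes its root-avoiding count extremal too.\<close>
    have "tcount c = fib (?c + 2)" using eq(1) card_mis_False[OF Node.prems] de by simp
    moreover from this have "card (mis c False) = fib (Suc ?c)"
      using eq(2) tcount_Node[OF Node.prems] de by (simp add: numeral_eq_Suc)
    ultimately obtain L where "c = chain L" using Node by auto
    then have "?t = chain ((a, b) # L)" using de by simp
    then show ?thesis by blast
  qed
  ultimately show ?case using le2 by blast
qed

text \<open>An empty first slot kills the slack of \<open>fib_branch\<close>, as
  \<open>fib 0 = 0\<close>. Equality then passes to both products and to each factor, so
  \<open>d\<close> and \<open>e\<close> attain both bounds of \<open>tcount_bound\<close>.\<close>

lemma tcount_eq_imp_chain:
  assumes wf: "wf_ptree (Node a b Tip d e)"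
    and eq: "tcount (Node a b Tip d e) = fib (tsize (Node a b Tip d e) + 2)"
  shows "\<exists>L M. d = chain L \<and> e = chain M"
proof -
  let ?d = "tsize d" and ?e = "tsize e"
  have okd: "wf_ptree d" "wf_ptree e" using wf by auto
  note d = tcount_bound[OF okd(1)] and e = tcount_bound[OF okd(2)]
  have "tcount d * tcount e + card (mis d False) * card (mis e False)
      = fib (?d + 2) * fib (?e + 2) + fib (Suc ?d) * fib (Suc ?e)"
    using eq tcount_Node[OF wf] fib_branch[of 0 ?d ?e] by (simp add: numeral_eq_Suc)
  moreover have "tcount d * tcount e \<le> fib (?d + 2) * fib (?e + 2)"
    "card (mis d False) * card (mis e False) \<le> fib (Suc ?d) * fib (Suc ?e)"
    using d e by (auto intro!: mult_mono)
  ultimately have eqs: "tcount d * tcount e = fib (?d + 2) * fib (?e + 2)"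
    "card (mis d False) * card (mis e False) = fib (Suc ?d) * fib (Suc ?e)" by linarith+
  \<comment> \<open>Positive upper bounds let equality of products descend to the factors.\<close>
  have *: "x = x' \<and> y = y'" if "x * y = x' * y'" "x \<le> x'" "y \<le> y'" "0 < x'" "0 < y'" for x y x' y' :: nat
  proof -
    have "0 < x * y" using that by simp
    then have "0 < x" "0 < y" by auto
    have "x = x'"
    proof (rule ccontr)
      assume "x \<noteq> x'"
      then have "x * y < x' * y'"
        using that \<open>0 < y\<close> by (meson le_neq_implies_less mult_le_mono2 mult_less_mono1 order_less_le_trans)
      then show False using that by simp
    qed
    then show ?thesis using that by simp
  qed
  have "tcount d = fib (?d + 2) \<and> tcount e = fib (?e + 2)"
    using d e eqs(1) by (intro *) (auto simp: fib_neq_0_nat)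
  moreover have "card (mis d False) = fib (Suc ?d) \<and> card (mis e False) = fib (Suc ?e)"
    using d e eqs(2) by (intro *) (auto simp: fib_neq_0_nat)
  ultimately show ?thesis using d e by blast
qed

lemma tsize_chain [simp]: "tsize (chain L) = length L"
  by (induction L rule: chain.induct) auto

text \<open>Here the counting formulas become the Fibonacci recursion: root-avoiding sets correspond
  to all sets of the tail, the others to root-avoiding sets of the tail.\<close>

lemma tcount_chain:
  "wf_ptree (chain L) \<Longrightarrow> card (mis (chain L) False) = fib (Suc (length L)) \<and> tcount (chain L) = fib (length L + 2)"
proof (induction L rule: chain.induct)
  case (2 a b xs)
  then have wf: "wf_ptree (Node a b (chain xs) Tip Tip)" by simp
  show ?case
    using 2 card_mis_False[OF wf] tcount_Node[OF wf] by (simp add: numeral_eq_Suc)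
qed (simp add: tcount_Tip numeral_eq_Suc)

lemma independent_ptree:
  assumes "wf_ptree t"
  shows "{I. I \<subseteq> tverts t \<and> indep (tarcs t) I \<and> card I = tsize t} = mis t False \<union> mis t True"
proof (rule set_eqI)
  fix I
  show "I \<in> {I. I \<subseteq> tverts t \<and> indep (tarcs t) I \<and> card I = tsize t} \<longleftrightarrow> I \<in> mis t False \<union> mis t True"
    using mis_properties[OF assms, of I] indep_card_le[OF assms, of I] by (cases "root_in t I") auto
qed

section \<open>Decomposition of rooted trees\<close>

text \<open>
  Every rooted tree with at least two vertices splits, at an edge \<open>{r, s}\<close> through its root \<open>r\<close>, into
  two rooted trees.
\<close>

inductive rtree :: "'a set \<Rightarrow> 'a rel \<Rightarrow> 'a \<Rightarrow> bool" where
  single: "rtree {r} {} r"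
| link: "rtree V D r \<Longrightarrow> rtree W E s \<Longrightarrow> V \<inter> W = {} \<Longrightarrow>
     rtree (V \<union> W) (D \<union> E \<union> {(r, s), (s, r)}) r"

lemma rtree_basic:
  "rtree V D r \<Longrightarrow> finite V \<and> r \<in> V \<and> D \<subseteq> V \<times> V \<and> (\<forall>v. (v, v) \<notin> D)"
  by (induction rule: rtree.induct) auto

lemma rtree_finite_Image: "rtree V D r \<Longrightarrow> finite (D `` S)"
  using rtree_basic[of V D r] finite_subset[of "D `` S" V] by blast

text \<open>The new vertex joins whichever half contains \<open>u\<close>. This is the growth step
  in \<open>undirected_tree_rtree\<close>.\<close>

lemma rtree_add_leaf:
  "rtree V D r \<Longrightarrow> u \<in> V \<Longrightarrow> w \<notin> V \<Longrightarrow> rtree (insert w V) (D \<union> {(u, w), (w, u)}) r"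
proof (induction rule: rtree.induct)
  case (single r)
  then show ?case using rtree.link[OF rtree.single[of r] rtree.single[of w]] by auto
next
  case (link V D r W E s)
  show ?case
  proof (cases "u \<in> V")
    case True
    then have "rtree (insert w V) (D \<union> {(u, w), (w, u)}) r" using link by simp
    from rtree.link[OF this link.hyps(2)] show ?thesis
      using link.hyps(3) link.prems(2) by (simp add: Un_ac insert_commute)
  next
    case False
    then have "rtree (insert w W) (E \<union> {(u, w), (w, u)}) s" using link by simp
    from rtree.link[OF link.hyps(1) this] show ?thesis
      using link.hyps(3) link.prems(2) by (simp add: Un_ac insert_commute)
  qed
qed

text \<open>The leaf is sought on the far side \<open>W\<close>: either \<open>W\<close> is just
  \<open>s\<close>, whose only neighbour is \<open>r\<close>, or \<open>W\<close> has a leaf other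
  than \<open>s\<close>, untouched by the linking edge.\<close>

lemma rtree_leaf:
  "rtree V D r \<Longrightarrow> V = {r} \<or> (\<exists>w\<in>V. w \<noteq> r \<and> (\<exists>x. D `` {w} = {x}))"
proof (induction rule: rtree.induct)
  case (link V D r W E s)
  note V = rtree_basic[OF link.hyps(1)] and W = rtree_basic[OF link.hyps(2)]
  have r: "r \<notin> W" "s \<notin> V" using V W link.hyps(3) by auto
  from link.IH(2) show ?case
  proof
    assume "W = {s}"
    then have "E = {}" using W by auto
    then have "(D \<union> E \<union> {(r, s), (s, r)}) `` {s} = {r}" using r V by auto
    moreover have "s \<noteq> r" using r W by auto
    ultimately show ?thesis using W by blast
  next
    assume "\<exists>w\<in>W. w \<noteq> s \<and> (\<exists>x. E `` {w} = {x})"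
    then obtain w x where w: "w \<in> W" "w \<noteq> s" "E `` {w} = {x}" by blast
    have "D `` {w} = {}" using w V link.hyps(3) by blast
    moreover have wr: "w \<noteq> r" using w r by blast
    moreover have "(D \<union> E \<union> {(r, s), (s, r)}) `` {w} = D `` {w} \<union> E `` {w}" if "w \<noteq> r"
      using w(2) that by blast
    ultimately have "(D \<union> E \<union> {(r, s), (s, r)}) `` {w} = {x}" using w(3) by simp
    then show ?thesis using w(1) wr by (intro disjI2 bexI[of _ w] conjI exI[of _ x]) simp_all
  qed
qed simp

section \<open>Two-colourings and independent sets of half the order\<close>

lemma indep_link:
  assumes "rtree V D r" "rtree W E s" "V \<inter> W = {}"
    and "I \<subseteq> V" "indep D I" "J \<subseteq> W" "indep E J" "r \<notin> I \<or> s \<notin> J"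
  shows "indep (D \<union> E \<union> {(r, s), (s, r)}) (I \<union> J)" "card (I \<union> J) = card I + card J"
proof -
  note V = rtree_basic[OF assms(1)] and W = rtree_basic[OF assms(2)]
  have "(I \<union> J) \<inter> V = I" "(I \<union> J) \<inter> W = J" using assms(3,4,6) by blast+
  then have "indep D (I \<union> J)" "indep E (I \<union> J)"
    using indep_Int[of D V "I \<union> J"] indep_Int[of E W "I \<union> J"] V W assms(5,7) by simp_all
  moreover have "r \<notin> J" "s \<notin> I" using V W assms(3,4,6) by blast+
  then have "indep {(r, s), (s, r)} (I \<union> J)" using assms(8) by (auto simp: indep_def)
  ultimately show "indep (D \<union> E \<union> {(r, s), (s, r)}) (I \<union> J)" by (simp only: indep_Un simp_thms)
  show "card (I \<union> J) = card I + card J"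
    using assms(3,4,6) V W by (intro card_Un_disjoint) (auto intro: finite_subset)
qed

text \<open>Swapping the colours in \<open>W\<close> gives \<open>r\<close> and \<open>s\<close>
  different colours, so the linking edge lies inside no class.\<close>

lemma rtree_two_colouring:
  "rtree V D r \<Longrightarrow> \<exists>I\<subseteq>V. r \<in> I \<and> indep D I \<and> indep D (V - I)"
proof (induction rule: rtree.induct)
  case (single r)
  then show ?case by (auto simp: indep_def)
next
  case (link V D r W E s)
  note V = rtree_basic[OF link.hyps(1)] and W = rtree_basic[OF link.hyps(2)]
  obtain I J where I: "I \<subseteq> V" "r \<in> I" "indep D I" "indep D (V - I)"
    and J: "J \<subseteq> W" "s \<in> J" "indep E J" "indep E (W - J)" using link.IH by blast
  have eq: "V \<union> W - (I \<union> (W - J)) = (V - I) \<union> J" using I(1) J(1) link.hyps(3) by auto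
  have "indep (D \<union> E \<union> {(r, s), (s, r)}) (I \<union> (W - J))"
    using indep_link(1)[OF link.hyps I(1,3), of "W - J"] J by blast
  moreover have "indep (D \<union> E \<union> {(r, s), (s, r)}) ((V - I) \<union> J)"
    using indep_link(1)[OF link.hyps _ I(4) J(1,3)] I(2) by blast
  ultimately show ?case using I J eq by (intro exI[of _ "I \<union> (W - J)"]) auto
qed

text \<open>The larger colour class gives the first claim. The sets \<open>V - I\<close> and
  \<open>I - {r}\<close> avoid \<open>r\<close> and have \<open>card V - 1\<close> vertices
  together, so the larger of them gives the second.\<close>

lemma rtree_indep_half:
  assumes "rtree V D r"
  shows "\<exists>I\<subseteq>V. indep D I \<and> card V \<le> 2 * card I"
    and "\<exists>I\<subseteq>V - {r}. indep D I \<and> card V \<le> 2 * card I + 1"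
proof -
  obtain I where I: "I \<subseteq> V" "r \<in> I" "indep D I" "indep D (V - I)"
    using rtree_two_colouring[OF assms] by blast
  have fin: "finite V" "finite I" using rtree_basic[OF assms] I(1) finite_subset by auto
  have c: "card (V - I) + card I = card V"
    using card_Diff_subset[OF fin(2) I(1)] card_mono[OF fin(1) I(1)] by simp
  have c': "Suc (card (I - {r})) = card I" using card_Suc_Diff1[OF fin(2) I(2)] .
  show "\<exists>I\<subseteq>V. indep D I \<and> card V \<le> 2 * card I"
  proof (cases "card V \<le> 2 * card I")
    case False
    then have "card V \<le> 2 * card (V - I)" using c by linarith
    then show ?thesis using I(4) by blast
  qed (use I in blast)
  have i: "indep D (I - {r})" using I(3) by (auto simp: indep_def)
  show "\<exists>I\<subseteq>V - {r}. indep D I \<and> card V \<le> 2 * card I + 1"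
  proof (cases "card V \<le> 2 * card (V - I) + 1")
    case False
    then have "card V \<le> 2 * card (I - {r}) + 1" using c c' by linarith
    then show ?thesis using i I(1) by (intro exI[of _ "I - {r}"]) auto
  next
    case True
    then show ?thesis using I(2,4) by (intro exI[of _ "V - I"]) auto
  qed
qed

text \<open>
  \<open>root_free\<close> describes trees with a matching that misses exactly the root.
\<close>

definition matched :: "'a set \<Rightarrow> 'a rel \<Rightarrow> 'a \<Rightarrow> bool" where
  "matched V D r \<longleftrightarrow> (\<exists>b c d e. wf_ptree (Node r b c d e) \<and> tverts (Node r b c d e) = V \<and> tarcs (Node r b c d e) = D)"

definition root_free :: "'a set \<Rightarrow> 'a rel \<Rightarrow> 'a \<Rightarrow> bool" where
  "root_free V D r \<longleftrightarrow> (\<exists>d e. wf_ptree d \<and> wf_ptree e \<and> tverts d \<inter> tverts e = {} \<and> r \<notin> tverts d \<and> r \<notin> tverts e \<and>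
     V = insert r (tverts d \<union> tverts e) \<and> D = join r d \<union> join r e \<union> tarcs d \<union> tarcs e)"

lemma even_card_matched: "matched V D r \<Longrightarrow> even (card V)"
  unfolding matched_def using card_tverts by (metis dvd_triv_left)

lemma odd_card_root_free: "root_free V D r \<Longrightarrow> odd (card V)"
  unfolding root_free_def by (auto simp: card_Un_disjoint card_tverts)

lemma join_nonempty: "t \<noteq> Tip \<Longrightarrow> \<exists>y\<in>tverts t. (x, y) \<in> join x t"
  by (cases t) auto

lemma matchedE:
  assumes "matched V D r"
  obtains t where "wf_ptree t" "tverts t = V" "tarcs t = D" "\<And>x. join x t = {(x, r), (r, x)}"
proof -
  obtain b c d e where "wf_ptree (Node r b c d e)" "tverts (Node r b c d e) = V" "tarcs (Node r b c d e) = D"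
    using assms unfolding matched_def by blast
  then show thesis using that join.simps(2) by metis
qed

text \<open>The vertex \<open>r\<close> already has its partner \<open>b\<close>; a degree of at
  most one leaves its slot \<open>c\<close> empty, and the new branch goes there.\<close>

lemma matched_add:
  assumes "matched V D r" "matched W E s" "V \<inter> W = {}" "card (D `` {r}) \<le> 1"
  shows "matched (V \<union> W) (D \<union> E \<union> {(r, s), (s, r)}) r"
proof -
  obtain b c d e where t: "wf_ptree (Node r b c d e)" "tverts (Node r b c d e) = V" "tarcs (Node r b c d e) = D"
    using assms(1) unfolding matched_def by blast
  obtain w where w: "wf_ptree w" "tverts w = W" "tarcs w = E" "\<And>x. join x w = {(x, s), (s, x)}"
    using matchedE[OF assms(2)] by blast
  have "c = Tip"
  proof (rule ccontr)
    assume "c \<noteq> Tip"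
    then obtain y where y: "y \<in> tverts c" "(r, y) \<in> join r c" using join_nonempty[of c r] by blast
    have "{b, y} \<subseteq> D `` {r}" using y t(3) by auto
    moreover have "D `` {r} \<subseteq> V" using t(2,3) tarcs_subset by blast
    moreover have "finite V" using t(2) finite_tverts by metis
    ultimately have "card {b, y} \<le> card (D `` {r})" by (meson card_mono finite_subset)
    moreover have "b \<noteq> y" using y t(1) by auto
    ultimately show False using assms(4) by simp
  qed
  have V: "V = insert r (insert b (tverts d \<union> tverts e))"
    and D: "D = {(r, b), (b, r)} \<union> join b d \<union> join b e \<union> tarcs d \<union> tarcs e"
    unfolding t(2,3)[symmetric] \<open>c = Tip\<close> by auto
  have "r \<notin> W" "b \<notin> W" "W \<inter> tverts d = {}" "W \<inter> tverts e = {}"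
    using assms(3) unfolding V by blast+
  then have "wf_ptree (Node r b w d e)" using t(1) w(1,2) by simp
  moreover have "tverts (Node r b w d e) = V \<union> W" unfolding V w(2)[symmetric] by auto
  moreover have "tarcs (Node r b w d e) = D \<union> E \<union> {(r, s), (s, r)}"
    unfolding D w(3)[symmetric] by (simp add: w(4) Un_ac insert_commute)
  ultimately show ?thesis unfolding matched_def by blast
qed

lemma root_free_slot:
  assumes "root_free V D r" "card (D `` {r}) \<le> 1"
  obtains d where "wf_ptree d" "r \<notin> tverts d" "V = insert r (tverts d)" "D = join r d \<union> tarcs d"
proof -
  obtain d e where t: "wf_ptree d" "wf_ptree e" "tverts d \<inter> tverts e = {}" "r \<notin> tverts d" "r \<notin> tverts e"
     "V = insert r (tverts d \<union> tverts e)" "D = join r d \<union> join r e \<union> tarcs d \<union> tarcs e"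
    using assms(1) unfolding root_free_def by blast
  have "d = Tip \<or> e = Tip"
  proof (rule ccontr)
    assume "\<not> (d = Tip \<or> e = Tip)"
    then obtain x y where xy: "x \<in> tverts d" "(r, x) \<in> join r d" "y \<in> tverts e" "(r, y) \<in> join r e"
      using join_nonempty[of d r] join_nonempty[of e r] by blast
    have "{x, y} \<subseteq> D `` {r}" using xy t(7) by auto
    moreover have "finite (D `` {r})"
    proof (rule finite_subset)
      show "D `` {r} \<subseteq> V"
        unfolding t(6,7) by (auto dest!: join_verts tarcs_verts)
    qed (simp add: t(6))
    ultimately have "card {x, y} \<le> card (D `` {r})" by (meson card_mono)
    moreover have "x \<noteq> y" using xy t(3) by auto
    ultimately show False using assms(2) by simp
  qed
  then show thesis using t that by (elim disjE) simp_all
qed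

lemma root_free_add:
  assumes "root_free V D r" "matched W E s" "V \<inter> W = {}" "card (D `` {r}) \<le> 1"
  shows "root_free (V \<union> W) (D \<union> E \<union> {(r, s), (s, r)}) r"
proof -
  obtain d where t: "wf_ptree d" "r \<notin> tverts d" "V = insert r (tverts d)" "D = join r d \<union> tarcs d"
    using root_free_slot[OF assms(1,4)] .
  obtain w where w: "wf_ptree w" "tverts w = W" "tarcs w = E" "\<And>x. join x w = {(x, s), (s, x)}"
    using matchedE[OF assms(2)] by blast
  have "tverts d \<inter> tverts w = {}" "r \<notin> tverts w" using t(3) w(2) assms(3) by auto
  moreover have "V \<union> W = insert r (tverts d \<union> tverts w)" using t(3) w(2) by simp
  moreover have "D \<union> E \<union> {(r, s), (s, r)} = join r d \<union> join r w \<union> tarcs d \<union> tarcs w"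
    using t(4) w(3,4) by (simp add: Un_ac)
  ultimately show ?thesis unfolding root_free_def
    using t(1,2) w(1) by blast
qed

text \<open>The linking edge becomes a matching edge. In the new node \<open>r\<close> has one slot
  and \<open>s\<close> has two, so a degree bound is required at \<open>r\<close> only.\<close>

lemma matched_root_free:
  assumes "root_free V D r" "root_free W E s" "V \<inter> W = {}" "card (D `` {r}) \<le> 1"
  shows "matched (V \<union> W) (D \<union> E \<union> {(r, s), (s, r)}) r"
proof -
  obtain c where t: "wf_ptree c" "r \<notin> tverts c" "V = insert r (tverts c)" "D = join r c \<union> tarcs c"
    using root_free_slot[OF assms(1,4)] .
  obtain d e where t': "wf_ptree d" "wf_ptree e" "tverts d \<inter> tverts e = {}" "s \<notin> tverts d" "s \<notin> tverts e"
     "W = insert s (tverts d \<union> tverts e)" "E = join s d \<union> join s e \<union> tarcs d \<union> tarcs e"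
    using assms(2) unfolding root_free_def by blast
  have "wf_ptree (Node r s c d e)"
    using t(1,2) t'(1-5) assms(3) unfolding t(3) t'(6) by auto
  moreover have "tverts (Node r s c d e) = V \<union> W" unfolding t(3) t'(6) by auto
  moreover have "tarcs (Node r s c d e) = D \<union> E \<union> {(r, s), (s, r)}"
    unfolding t(4) t'(7) by auto
  ultimately show ?thesis unfolding matched_def by blast
qed

text \<open>
  The two-colouring supplies an independent set of at least half the vertices on either side of the
  splitting edge; the parity of the branch sizes makes this bound strict where that is needed.
\<close>

lemma rtree_decomp:
  assumes "rtree V D r" "\<forall>v\<in>V. card (D `` {v}) \<le> 3" "card (D `` {r}) \<le> 2"
  shows "((\<exists>I\<subseteq>V. indep D I \<and> card V < 2 * card I) \<or> matched V D r) \<and>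
    ((\<exists>I\<subseteq>V - {r}. indep D I \<and> card V \<le> 2 * card I) \<or> root_free V D r)"
  using assms
proof (induction rule: rtree.induct)
  case (single r)
  have "root_free {r} {} r" unfolding root_free_def
    by (intro exI[of _ Tip]) simp
  moreover have "indep {} {r}" by (simp add: indep_def)
  ultimately show ?case by (auto intro!: exI[of _ "{r}"])
next
  case (link V D r W E s)
  let ?D = "D \<union> E \<union> {(r, s), (s, r)}"
  note V = rtree_basic[OF link.hyps(1)] and W = rtree_basic[OF link.hyps(2)]
  note half = rtree_indep_half[OF link.hyps(1)] rtree_indep_half[OF link.hyps(2)]
  have fin: "finite (?D `` {v})" for v
    using rtree_finite_Image[OF rtree.link[OF link.hyps]] .
  have rs: "s \<notin> V" "r \<notin> W" using link.hyps(3) V W by auto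
  \<comment> \<open>The linking edge takes one unit of degree from \<open>r\<close> and one from
    \<open>s\<close>, which leaves both halves within the root bound 2 of the induction
    hypothesis.\<close>
  have deg1: "card (D `` {r}) \<le> 1"
  proof -
    have "?D `` {r} = insert s (D `` {r})" using rs W by auto
    moreover have "s \<notin> D `` {r}" using rs V by auto
    ultimately show ?thesis
      using link.prems(2) rtree_finite_Image[OF link.hyps(1), of "{r}"] by simp
  qed
  have deg2: "card (E `` {s}) \<le> 2"
  proof -
    have "?D `` {s} = insert r (E `` {s})" using rs V by auto
    moreover have "r \<notin> E `` {s}" using rs W by auto
    moreover have "card (?D `` {s}) \<le> 3" using link.prems(1) W by blast
    ultimately show ?thesis
      using rtree_finite_Image[OF link.hyps(2), of "{s}"] by simp
  qed
  have deg3: "\<forall>v\<in>V. card (D `` {v}) \<le> 3" "\<forall>v\<in>W. card (E `` {v}) \<le> 3"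
  proof -
    have "card (D `` {v}) \<le> card (?D `` {v})" "card (E `` {v}) \<le> card (?D `` {v})" for v
      by (intro card_mono[OF fin]; blast)+
    then show "\<forall>v\<in>V. card (D `` {v}) \<le> 3" "\<forall>v\<in>W. card (E `` {v}) \<le> 3"
      using link.prems(1) by (meson UnI1 UnI2 order_trans)+
  qed
  have IHV: "(\<exists>I\<subseteq>V. indep D I \<and> card V < 2 * card I) \<or> matched V D r"
    "(\<exists>I\<subseteq>V - {r}. indep D I \<and> card V \<le> 2 * card I) \<or> root_free V D r"
    using link.IH(1) deg3(1) deg1 by auto
  have IHW: "(\<exists>I\<subseteq>W. indep E I \<and> card W < 2 * card I) \<or> matched W E s"
    "(\<exists>I\<subseteq>W - {s}. indep E I \<and> card W \<le> 2 * card I) \<or> root_free W E s"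
    using link.IH(2) deg3(2) deg2 by auto
  have cVW: "card (V \<union> W) = card V + card W"
    using V W link.hyps(3) by (simp add: card_Un_disjoint)
  have comb: "\<exists>K\<subseteq>V \<union> W. indep ?D K \<and> card (V \<union> W) < 2 * card K"
    if "I \<subseteq> V" "indep D I" "J \<subseteq> W" "indep E J" "r \<notin> I \<or> s \<notin> J"
      "card V + card W < 2 * card I + 2 * card J" for I J
    using indep_link[OF link.hyps that(1-5)] that(1,3,6) cVW
    by (intro exI[of _ "I \<union> J"]) auto
  have comb': "\<exists>K\<subseteq>V \<union> W - {r}. indep ?D K \<and> card (V \<union> W) \<le> 2 * card K"
    if "I \<subseteq> V - {r}" "indep D I" "J \<subseteq> W" "indep E J"
      "card V + card W \<le> 2 * card I + 2 * card J" for I J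
  proof -
    have "I \<subseteq> V" "r \<notin> I \<or> s \<notin> J" using that by auto
    from indep_link[OF link.hyps this(1) that(2-4) this(2)] show ?thesis
      using that(1,3,5) cVW rs by (intro exI[of _ "I \<union> J"]) auto
  qed
  have "(\<exists>K\<subseteq>V \<union> W. indep ?D K \<and> card (V \<union> W) < 2 * card K) \<or> matched (V \<union> W) ?D r"
  \<comment> \<open>Decisive is whether \<open>W\<close> still offers half its order without
    \<open>s\<close>. If not, \<open>W\<close> is \<open>root_free\<close>, and \<open>r\<close> is
    the candidate partner of \<open>s\<close>.\<close>
  proof (cases "\<exists>J\<subseteq>W - {s}. indep E J \<and> card W \<le> 2 * card J")
    case False
    then have Wf: "root_free W E s" using IHW(2) by blast
    show ?thesis
    proof (cases "\<exists>I\<subseteq>V - {r}. indep D I \<and> card V \<le> 2 * card I")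
      case True
      then obtain I where I: "I \<subseteq> V - {r}" "indep D I" "card V \<le> 2 * card I" by blast
      obtain J where J: "J \<subseteq> W" "indep E J" "card W \<le> 2 * card J" using half(3) by blast
      \<comment> \<open>As \<open>card W\<close> is odd, the bound on \<open>J\<close> is
        strict.\<close>
      have "card W \<noteq> 2 * card J" using odd_card_root_free[OF Wf] by auto
      then show ?thesis using comb[of I J] I J by auto
    next
      case False
      then have "root_free V D r" using IHV(2) by blast
      from matched_root_free[OF this Wf link.hyps(3) deg1] show ?thesis by blast
    qed
  next
    case True
    then obtain J where J: "J \<subseteq> W - {s}" "indep E J" "card W \<le> 2 * card J" by blast
    show ?thesis
    proof (cases "\<exists>I\<subseteq>V. indep D I \<and> card V < 2 * card I")
      case True
      then obtain I where "I \<subseteq> V" "indep D I" "card V < 2 * card I" by blast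
      then show ?thesis using comb[of I J] J by auto
    next
      case False
      then have Vm: "matched V D r" using IHV(1) by blast
      show ?thesis
      proof (cases "\<exists>J\<subseteq>W. indep E J \<and> card W < 2 * card J")
        case True
        then obtain J where J: "J \<subseteq> W" "indep E J" "card W < 2 * card J" by blast
        obtain I where I: "I \<subseteq> V - {r}" "indep D I" "card V \<le> 2 * card I + 1" using half(2) by blast
        \<comment> \<open>As \<open>card V\<close> is even, the bound on \<open>I\<close> loses its
          \<open>+ 1\<close>, and avoiding \<open>r\<close> costs nothing.\<close>
        have "card V \<noteq> 2 * card I + 1" using even_card_matched[OF Vm] by auto
        then show ?thesis using comb[of I J] I J by auto
      next
        case False
        then have "matched W E s" using IHW(1) by blast
        from matched_add[OF Vm this link.hyps(3) deg1] show ?thesis by blast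
      qed
    qed
  qed
  moreover have "(\<exists>K\<subseteq>V \<union> W - {r}. indep ?D K \<and> card (V \<union> W) \<le> 2 * card K) \<or> root_free (V \<union> W) ?D r"
  proof (cases "\<exists>I\<subseteq>V - {r}. indep D I \<and> card V \<le> 2 * card I")
    case True
    then obtain I where I: "I \<subseteq> V - {r}" "indep D I" "card V \<le> 2 * card I" by blast
    obtain J where J: "J \<subseteq> W" "indep E J" "card W \<le> 2 * card J" using half(3) by blast
    then show ?thesis using comb'[of I J] I by auto
  next
    case False
    then have Vf: "root_free V D r" using IHV(2) by blast
    show ?thesis
    proof (cases "\<exists>J\<subseteq>W. indep E J \<and> card W < 2 * card J")
      case True
      then obtain J where J: "J \<subseteq> W" "indep E J" "card W < 2 * card J" by blast
      \<comment> \<open>The strict surplus of \<open>J\<close> makes up for the \<open>+ 1\<close>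
        lost by avoiding \<open>r\<close>.\<close>
      obtain I where I: "I \<subseteq> V - {r}" "indep D I" "card V \<le> 2 * card I + 1" using half(2) by blast
      then show ?thesis using comb'[of I J] I J by auto
    next
      case False
      then have "matched W E s" using IHW(1) by blast
      from root_free_add[OF Vf this link.hyps(3) deg1] show ?thesis by blast
    qed
  qed
  ultimately show ?case by blast
qed

section \<open>From undirected trees to rooted trees\<close>

lemma rtree_apath:
  "rtree V D r \<Longrightarrow> x \<in> V \<Longrightarrow> y \<in> V \<Longrightarrow> \<exists>p. pre_digraph.apath (with_proj \<lparr>pverts = V, parcs = D\<rparr>) x p y"
proof -
  assume tree: "rtree V D r" and xy: "x \<in> V" "y \<in> V"
  \<comment> \<open>Each vertex reaches \<open>r\<close> and is reached from it, through the edge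
    \<open>{r, s}\<close> when it lies in \<open>W\<close>; so any two are joined via
    \<open>r\<close>.\<close>
  have reach: "(x, y) \<in> rtrancl_on V D" using tree xy
  proof (induction arbitrary: x y rule: rtree.induct)
    case (single r)
    then show ?case by auto
  next
    case (link V D r W E s)
    let ?D = "D \<union> E \<union> {(r, s), (s, r)}"
    note V = rtree_basic[OF link.hyps(1)] and W = rtree_basic[OF link.hyps(2)]
    have mV: "(u, v) \<in> rtrancl_on (V \<union> W) ?D" if "u \<in> V" "v \<in> V" for u v
      by (rule rtrancl_on_mono[OF _ _ link.IH(1)[OF that]]) blast+
    have mW: "(u, v) \<in> rtrancl_on (V \<union> W) ?D" if "u \<in> W" "v \<in> W" for u v
      by (rule rtrancl_on_mono[OF _ _ link.IH(2)[OF that]]) blast+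
    have rs: "(r, s) \<in> rtrancl_on (V \<union> W) ?D" "(s, r) \<in> rtrancl_on (V \<union> W) ?D"
      using V W by (blast intro: rtrancl_on_into_rtrancl_on[OF rtrancl_on_refl])+
    have via_r: "(u, r) \<in> rtrancl_on (V \<union> W) ?D" "(r, u) \<in> rtrancl_on (V \<union> W) ?D"
      if "u \<in> V \<union> W" for u
    proof -
      show "(u, r) \<in> rtrancl_on (V \<union> W) ?D"
        using that mV[of u r] rtrancl_on_trans[OF mW[of u s] rs(2)] V W by blast
      show "(r, u) \<in> rtrancl_on (V \<union> W) ?D"
        using that mV[of r u] rtrancl_on_trans[OF rs(1) mW[of s u]] V W by blast
    qed
    show ?case
      using rtrancl_on_trans[OF via_r(1) via_r(2)] link.prems by blast
  qed
  interpret H: pair_wf_digraph "\<lparr>pverts = V, parcs = D\<rparr>"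
    using rtree_basic[OF tree] by unfold_locales auto
  show ?thesis using reach H.reachable_apath[of x y] by (simp add: reachable_def)
qed

lemma pcas_snoc: "pcas u p v \<Longrightarrow> pcas u (p @ [(v, w)]) w \<and> pawalk_verts u (p @ [(v, w)]) = pawalk_verts u p @ [w]"
  by (induction p arbitrary: u) auto

lemma rtrancl_on_crossing:
  "(x, y) \<in> rtrancl_on V E \<Longrightarrow> x \<in> U \<Longrightarrow> y \<notin> U \<Longrightarrow> \<exists>u\<in>U. \<exists>w\<in>V - U. (u, w) \<in> E"
  by (induction rule: rtrancl_on_induct) blast+

text \<open>Take an inclusion-maximal vertex set that induces a tree rooted at \<open>r\<close>. If
  it is proper, connectivity gives an edge leaving it. The outer end has only one neighbour inside,
  as a second would close a cycle, so it can be added as a leaf.\<close>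

lemma undirected_tree_rtree:
  assumes "undirected_tree T" "r \<in> pverts T"
  shows "rtree (pverts T) (parcs T) r"
proof -
  let ?V = "pverts T" and ?E = "parcs T"
  interpret T: pair_graph T using assms(1) unfolding undirected_tree_def by blast
  have sym: "(u, v) \<in> ?E \<Longrightarrow> (v, u) \<in> ?E" for u v
    using T.pair_sym_arcs by (auto simp: symmetric_def dest: symD)
  have loop: "(u, u) \<notin> ?E" for u using T.pair_no_loops by fastforce
  have conn: "(u, v) \<in> rtrancl_on ?V ?E" if "u \<in> ?V" "v \<in> ?V" for u v
  proof -
    \<comment> \<open>\<open>connected\<close> refers to the symmetric closure, which here is the
      arc set itself.\<close>
    have "(\<Union>e\<in>?E. {(fst e, snd e), (snd e, fst e)}) = ?E" using sym by auto
    then show ?thesis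
      using assms(1) that unfolding undirected_tree_def connected_def strongly_connected_def reachable_def
      by (simp add: parcs_mk_symmetric)
  qed
  define P where "P = {U. U \<subseteq> ?V \<and> rtree U (?E \<inter> U \<times> U) r}"
  have "?E \<inter> {r} \<times> {r} = {}" using loop by auto
  then have "{r} \<in> P" using assms(2) rtree.single[of r] unfolding P_def by simp
  then have "P \<noteq> {}" by blast
  moreover have "finite P" unfolding P_def using T.pair_finite_verts by simp
  ultimately obtain U where U: "U \<in> P" and max: "\<And>W. W \<in> P \<Longrightarrow> U \<subseteq> W \<Longrightarrow> U = W"
    using finite_has_maximal[of P] by auto
  let ?D = "?E \<inter> U \<times> U"
  have tree: "rtree U ?D r" and UV: "U \<subseteq> ?V" using U unfolding P_def by auto
  have "U = ?V"
  proof (rule ccontr)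
    assume "U \<noteq> ?V"
    then obtain x where "x \<in> ?V" "x \<notin> U" using UV by blast
    moreover have "r \<in> U" using rtree_basic[OF tree] by simp
    ultimately have "\<exists>u\<in>U. \<exists>w\<in>?V - U. (u, w) \<in> ?E"
      using rtrancl_on_crossing[OF conn[OF assms(2)]] by simp
    then obtain u w where uw: "u \<in> U" "w \<in> ?V" "w \<notin> U" "(u, w) \<in> ?E" by blast
    have uniq: "u' = u" if u': "u' \<in> U" "(u', w) \<in> ?E" for u'
    proof (rule ccontr)
      assume "u' \<noteq> u"
      interpret H: pair_wf_digraph "\<lparr>pverts = U, parcs = ?D\<rparr>" by unfold_locales auto
      obtain p where p: "H.apath u p u'" using rtree_apath[OF tree uw(1) u'(1)] by blast
      have cas: "pcas u p u'" and vs: "set (pawalk_verts u p) \<subseteq> U" and arcs: "set p \<subseteq> ?D"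
        and dist: "distinct (pawalk_verts u p)"
        using p unfolding H.apath_def by (auto elim!: H.awalkE)
      have "p \<noteq> []" using cas \<open>u' \<noteq> u\<close> by auto
      \<comment> \<open>Two neighbours of \<open>w\<close> in \<open>U\<close>, joined by the path
        \<open>p\<close> within \<open>U\<close>, close a cycle through \<open>w\<close>; as
        \<open>p\<close> is nonempty, its length is at least 3.\<close>
      let ?q = "(w, u) # p @ [(u', w)]"
      have "T.awalk w ?q w"
        using pcas_snoc[OF cas, of w] arcs uw sym u' by (auto simp: T.awalk_def)
      moreover have "distinct (tl (pawalk_verts w ?q))"
        using pcas_snoc[OF cas, of w] dist vs uw(3) by auto
      ultimately have "T.cycle ?q" unfolding T.cycle_def by blast
      moreover have "3 \<le> length ?q" using \<open>p \<noteq> []\<close> by (cases p) auto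
      ultimately show False using assms(1) unfolding undirected_tree_def by blast
    qed
    have "(a, b) \<in> ?E \<inter> insert w U \<times> insert w U \<longleftrightarrow> (a, b) \<in> ?D \<union> {(u, w), (w, u)}" for a b
      using uw uniq[of a] uniq[of b] sym[of w b] sym[of u w] loop[of w] by auto
    then have "?E \<inter> insert w U \<times> insert w U = ?D \<union> {(u, w), (w, u)}"
      by (intro equalityI subrelI) blast+
    then have "insert w U \<in> P"
      using rtree_add_leaf[OF tree uw(1,3)] uw(2) UV unfolding P_def by simp
    then show False using max[of "insert w U"] uw(3) by blast
  qed
  moreover have "?E \<inter> ?V \<times> ?V = ?E" using T.wellformed' by auto
  ultimately show ?thesis using tree by simp
qed

section \<open>Combs\<close>

text \<open>First components run along the path, second components are the attached endvertices.
  Admitting empty lists makes \<open>comb_append\<close> hold without conditions.\<close>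

definition linked :: "('a \<times> 'a) list \<Rightarrow> ('a \<times> 'a) list \<Rightarrow> 'a rel" where
  "linked xs ys = (if xs = [] \<or> ys = [] then {}
     else {(fst (last xs), fst (hd ys)), (fst (hd ys), fst (last xs))})"

primrec comb :: "('a \<times> 'a) list \<Rightarrow> 'a rel" where
  "comb [] = {}"
| "comb (x # xs) = {(fst x, snd x), (snd x, fst x)} \<union> linked [x] xs \<union> comb xs"

lemma comb_append: "comb (xs @ ys) = comb xs \<union> comb ys \<union> linked xs ys"
proof (induction xs)
  case (Cons x xs)
  have "linked [x] (xs @ ys) \<union> linked xs ys = linked [x] xs \<union> linked (x # xs) ys"
    by (cases xs) (auto simp: linked_def)
  then show ?case using Cons by (simp add: Un_ac)
qed (simp add: linked_def)

lemma comb_rev: "comb (rev xs) = comb xs"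
proof (induction xs)
  case (Cons x xs)
  have "linked (rev xs) [x] = linked [x] xs"
    by (auto simp: linked_def last_rev)
  moreover have "linked [x] [] = {}" by (simp add: linked_def)
  ultimately show ?case using Cons by (simp add: comb_append Un_ac insert_commute)
qed simp

lemma linked_map: "linked (map (map_prod f f) xs) (map (map_prod f f) ys) = map_prod f f ` linked xs ys"
  by (auto simp: linked_def last_map hd_map)

lemma comb_map: "comb (map (map_prod f f) xs) = map_prod f f ` comb xs"
proof (induction xs)
  case (Cons x xs)
  then show ?case using linked_map[of f "[x]" xs] by (cases x) (simp add: image_Un)
qed simp

lemma tverts_chain: "tverts (chain L) = set (map fst L @ map snd L)"
  by (induction L rule: chain.induct) auto

text \<open>Only first components enter \<open>linked\<close>, so \<open>y\<close> is
  arbitrary.\<close>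

lemma join_chain: "join x (chain L) = linked [(x, y)] L"
  by (cases L rule: chain.cases) (auto simp: linked_def)

lemma tarcs_chain: "tarcs (chain L) = comb L"
  by (induction L rule: chain.induct) (auto simp: join_chain[of _ _ undefined] linked_def)

lemma wf_ptree_chain: "wf_ptree (chain L) \<longleftrightarrow> distinct (map fst L @ map snd L)"
  by (induction L rule: chain.induct) (auto simp: tverts_chain)

abbreviation is_comb :: "'a set \<Rightarrow> 'a rel \<Rightarrow> ('a \<times> 'a) list \<Rightarrow> bool" where
  "is_comb V D L \<equiv> distinct (map fst L @ map snd L) \<and> V = set (map fst L @ map snd L) \<and> D = comb L"

text \<open>The path of the comb runs through the first chain in reverse, then \<open>b\<close>,
  then the second chain; \<open>a\<close> is the endvertex at \<open>b\<close>. Reversal is harmless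
  by \<open>comb_rev\<close>.\<close>

lemma is_comb_two_chains:
  assumes "wf_ptree (Node a b Tip (chain L) (chain M))"
  shows "is_comb (tverts (Node a b Tip (chain L) (chain M))) (tarcs (Node a b Tip (chain L) (chain M)))
    (rev L @ (b, a) # M)"
proof (intro conjI)
  have "distinct (map fst L @ map snd L)" "distinct (map fst M @ map snd M)"
    using assms wf_ptree_chain[of L] wf_ptree_chain[of M] by auto
  then show "distinct (map fst (rev L @ (b, a) # M) @ map snd (rev L @ (b, a) # M))"
    using assms unfolding wf_ptree.simps tverts_chain by (auto simp: rev_map[symmetric])
  show "tverts (Node a b Tip (chain L) (chain M))
      = set (map fst (rev L @ (b, a) # M) @ map snd (rev L @ (b, a) # M))"
    by (auto simp: tverts_chain)
  have "linked (rev L) ((b, a) # M) = join b (chain L)"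
    unfolding join_chain[of b L a] by (auto simp: linked_def last_rev)
  then show "tarcs (Node a b Tip (chain L) (chain M)) = comb (rev L @ (b, a) # M)"
    by (simp add: comb_append comb_rev tarcs_chain join_chain[of b M a, symmetric] Un_ac insert_commute)
qed

definition comb_T :: "nat \<Rightarrow> ((nat \<times> bool) \<times> (nat \<times> bool)) list" where
  "comb_T k = map (\<lambda>i. ((i, False), (i, True))) [0..<k]"

lemma is_comb_T_graph: "is_comb (pverts (T_graph k)) (parcs (T_graph k)) (comb_T k)"
proof (intro conjI)
  show "distinct (map fst (comb_T k) @ map snd (comb_T k))"
    by (auto simp: comb_T_def distinct_map inj_on_def comp_def)
  show "pverts (T_graph k) = set (map fst (comb_T k) @ map snd (comb_T k))"
  proof -
    have "x \<in> {..<k} \<times> UNIV \<longleftrightarrow> x \<in> (\<lambda>i. (i, False)) ` {..<k} \<union> (\<lambda>i. (i, True)) ` {..<k}" for x :: "nat \<times> bool"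
      by (cases x; cases "snd x") auto
    then show ?thesis
      by (auto simp: T_graph_def Let_def comb_T_def comp_def atLeast0LessThan)
  qed
  show "parcs (T_graph k) = comb (comb_T k)"
  proof (induction k)
    case 0
    then show ?case by (simp add: T_graph_def comb_T_def)
  next
    case (Suc k)
    have link: "linked (comb_T k) [((k, False), (k, True))] =
        {((i, False), (Suc i, False)) |i. Suc i = k} \<union> {((i, False), (Suc i, False)) |i. Suc i = k}\<inverse>"
      by (cases k) (auto simp: linked_def comb_T_def)
    have "parcs (T_graph (Suc k)) = parcs (T_graph k) \<union>
        {((k, False), (k, True)), ((k, True), (k, False))} \<union>
        ({((i, False), (Suc i, False)) |i. Suc i = k} \<union> {((i, False), (Suc i, False)) |i. Suc i = k}\<inverse>)"
      by (auto simp: T_graph_def Let_def less_Suc_eq)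
    also have "\<dots> = comb (comb_T (Suc k))"
    proof -
      have "comb_T (Suc k) = comb_T k @ [((k, False), (k, True))]" by (simp add: comb_T_def)
      then show ?thesis unfolding Suc link[symmetric] comb_append by (simp add: comb_append) (simp add: linked_def)
    qed
    finally show ?case .
  qed
qed

lemma length_comb_T [simp]: "length (comb_T k) = k"
  by (simp add: comb_T_def)

text \<open>Replaces isomorphism by a listing of \<open>G\<close> as a comb: an isomorphism
  transports \<open>comb_T k\<close>, and conversely the list positions define the vertex
  map.\<close>

lemma digraph_iso_T_graph_iff:
  assumes "pair_graph G"
  shows "digraph_iso (with_proj G) (with_proj (T_graph k)) \<longleftrightarrow>
    (\<exists>L. length L = k \<and> is_comb (pverts G) (parcs G) L)" (is "?iso \<longleftrightarrow> ?comb")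
proof
  interpret G: pair_graph G by fact
  interpret T: pair_graph "T_graph k" by (rule pair_graph_T_graph)
  have T: "distinct (map fst (comb_T k) @ map snd (comb_T k))"
    "pverts (T_graph k) = set (map fst (comb_T k) @ map snd (comb_T k))"
    "parcs (T_graph k) = comb (comb_T k)"
    using is_comb_T_graph[of k] by blast+
  {
    assume ?iso
    then have "digraph_iso (with_proj (T_graph k)) (with_proj G)"
      using digraph_iso_swap G.wf_digraph_axioms by blast
    then obtain h where h: "pre_digraph.digraph_isomorphism (with_proj (T_graph k)) h"
      and app: "with_proj G = app_iso h (with_proj (T_graph k))" unfolding digraph_iso_def by blast
    let ?f = "iso_verts h" and ?L = "map (map_prod (iso_verts h) (iso_verts h)) (comb_T k)"
    have inj: "inj_on ?f (pverts (T_graph k))"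
      using h unfolding pre_digraph.digraph_isomorphism_def by simp
    have V: "pverts G = ?f ` pverts (T_graph k)"
      using arg_cong[OF app, of verts] by simp
    \<comment> \<open>Both graphs have \<open>fst\<close> and \<open>snd\<close> as tail and head,
      which forces the arc map to act componentwise on arcs.\<close>
    have tail: "iso_tail h = fst" and head: "iso_head h = snd"
      using arg_cong[OF app, of tail] arg_cong[OF app, of head] by simp_all
    have "iso_arcs h e = map_prod ?f ?f e" if "e \<in> parcs (T_graph k)" for e
      using h that unfolding pre_digraph.digraph_isomorphism_def tail head
      by (simp add: prod_eq_iff)
    then have "iso_arcs h ` parcs (T_graph k) = map_prod ?f ?f ` parcs (T_graph k)"
      by (rule image_cong[OF refl])
    moreover have "parcs G = iso_arcs h ` parcs (T_graph k)"
      using arg_cong[OF app, of arcs] by simp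
    ultimately have "parcs G = map_prod ?f ?f ` parcs (T_graph k)" by (rule trans[rotated])
    then have "parcs G = comb ?L" by (simp only: comb_map T(3))
    moreover have L: "map fst ?L @ map snd ?L = map ?f (map fst (comb_T k) @ map snd (comb_T k))"
      by simp
    moreover have "distinct (map ?f (map fst (comb_T k) @ map snd (comb_T k)))"
      using T(1) inj unfolding T(2) distinct_map by blast
    moreover have "pverts G = set (map ?f (map fst (comb_T k) @ map snd (comb_T k)))"
      unfolding V T(2) set_map ..
    ultimately show ?comb by (intro exI[of _ ?L]) (simp only: length_map length_comb_T)
  next
    assume ?comb
    then obtain L where len: "length L = k" and L: "is_comb (pverts G) (parcs G) L" by blast
    define f where "f = (\<lambda>(i, q). if q then snd (L ! i) else fst (L ! i))"
    have mapL: "map (map_prod f f) (comb_T k) = L"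
      by (rule nth_equalityI) (simp_all add: len comb_T_def f_def)
    have map_f: "map f (map fst (comb_T k) @ map snd (comb_T k)) = map fst L @ map snd L"
      unfolding mapL[symmetric] by simp
    have inj: "inj_on f (pverts (T_graph k))"
      using L unfolding T(2) map_f[symmetric] distinct_map by blast
    have V: "f ` pverts (T_graph k) = pverts G"
      using L unfolding T(2) map_f[symmetric] set_map by blast
    have E: "map_prod f f ` parcs (T_graph k) = parcs G"
      using L comb_map[of f "comb_T k"] unfolding T(3) mapL by simp
    let ?h = "\<lparr>iso_verts = f, iso_arcs = map_prod f f, iso_head = snd, iso_tail = fst\<rparr>"
    have "inj_on (map_prod f f) (parcs (T_graph k))"
    proof (rule inj_onI)
      fix x y assume "x \<in> parcs (T_graph k)" "y \<in> parcs (T_graph k)" "map_prod f f x = map_prod f f y"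
      then show "x = y"
        using inj T.wellformed' by (cases x; cases y) (auto dest: inj_onD)
    qed
    then have "pre_digraph.digraph_isomorphism (with_proj (T_graph k)) ?h"
      using inj T.wf_digraph_axioms unfolding pre_digraph.digraph_isomorphism_def by simp
    moreover have "with_proj G = app_iso ?h (with_proj (T_graph k))"
      by (simp add: app_iso_def V E with_proj_def)
    ultimately have "digraph_iso (with_proj (T_graph k)) (with_proj G)"
      unfolding digraph_iso_def by blast
    then show ?iso using digraph_iso_swap T.wf_digraph_axioms by blast
  }
qed

section \<open>The bound\<close>

lemma independent_set_iff_indep:
  assumes "pair_graph G"
  shows "independent_set G S \<longleftrightarrow> S \<subseteq> pverts G \<and> indep (parcs G) S"
proof -
  interpret G: pair_graph G by fact
  have "(u, u) \<notin> parcs G" for u using G.pair_no_loops by fastforce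
  then show ?thesis unfolding independent_set_def indep_def by metis
qed

lemma num_max_independent_sets_ptree:
  assumes "pair_graph G" "wf_ptree t" "pverts G = tverts t" "parcs G = tarcs t" "independence_number G = tsize t"
  shows "num_max_independent_sets G = tcount t"
  unfolding num_max_independent_sets_def tcount_def independent_ptree[OF assms(2), symmetric]
    independent_set_iff_indep[OF assms(1)] assms(3-5) by (simp add: conj_assoc)

theorem theorem4:
  fixes T :: "'a pair_pre_digraph" and n \<alpha> :: nat
  assumes "undirected_tree T" and "subcubic T"
    and "card (pverts T) = n"
    and "independence_number T = \<alpha>" and "real \<alpha> = real n / 2"
  shows "num_max_independent_sets T \<le> fib (\<alpha> + 2) \<and>
    (num_max_independent_sets T = fib (\<alpha> + 2) \<longleftrightarrow>
       digraph_iso (with_proj T) (with_proj (T_graph \<alpha>)))"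
proof -
  let ?V = "pverts T" and ?E = "parcs T"
  have pg: "pair_graph T" using assms(1) unfolding undirected_tree_def by blast
  interpret T: pair_graph T by (rule pg)
  have n: "card ?V = 2 * \<alpha>" using assms(3,5) by linarith
  have fin: "finite ?V" by (rule T.pair_finite_verts)
  have "?V \<noteq> {}"
    using assms(1) unfolding undirected_tree_def connected_def strongly_connected_def by simp
  then obtain r where r: "r \<in> ?V" by blast
  \<comment> \<open>The order is even, so \<open>T\<close> is not a single vertex and has a
    leaf.\<close>
  have "?V \<noteq> {r}" using n by (auto dest: arg_cong[of _ _ even])
  then obtain w x where w: "w \<in> ?V" "?E `` {w} = {x}"
    using rtree_leaf[OF undirected_tree_rtree[OF assms(1) r]] by blast
  \<comment> \<open>Rooting at the leaf \<open>w\<close> meets the root bound of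
    \<open>rtree_decomp\<close> and later empties the slot \<open>c\<close>.\<close>
  have tree: "rtree ?V ?E w" using undirected_tree_rtree[OF assms(1) w(1)] .
  have deg: "\<forall>v\<in>?V. card (?E `` {v}) \<le> 3"
  proof
    fix v assume v: "v \<in> ?V"
    have "out_arcs (with_proj T) v = Pair v ` (?E `` {v})" by (auto simp: out_arcs_def)
    then have "out_degree (with_proj T) v = card (?E `` {v})"
      by (simp add: out_degree_def card_image inj_on_def)
    moreover have "out_degree (with_proj T) v \<le> max_degree T"
      unfolding max_degree_def using v fin by (intro Max_ge) auto
    ultimately show "card (?E `` {v}) \<le> 3" using assms(2) unfolding subcubic_def by linarith
  qed
  have le\<alpha>: "card I \<le> \<alpha>" if "I \<subseteq> ?V" "indep ?E I" for I
  proof -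
    have "finite {S. independent_set T S}"
      using fin finite_subset[of _ "Pow ?V"] by (auto simp: independent_set_def)
    moreover have "independent_set T I" using that independent_set_iff_indep[OF pg] by blast
    ultimately show ?thesis
      unfolding assms(4)[symmetric] independence_number_def by (intro Max_ge) auto
  qed
  \<comment> \<open>An independent set larger than half the order would exceed
    \<open>\<alpha>\<close>, so \<open>rtree_decomp\<close> must yield the matching.\<close>
  have "\<not> card ?V < 2 * card I" if "I \<subseteq> ?V" "indep ?E I" for I
    using le\<alpha>[OF that] n by linarith
  then have "\<not> (\<exists>I\<subseteq>?V. indep ?E I \<and> card ?V < 2 * card I)" by blast
  moreover have "card (?E `` {w}) \<le> 2" using w(2) by simp
  ultimately have "matched ?V ?E w" using rtree_decomp[OF tree deg] by blast
  then obtain b c d e where t: "wf_ptree (Node w b c d e)" "tverts (Node w b c d e) = ?V" "tarcs (Node w b c d e) = ?E"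
    unfolding matched_def by blast
  have "c = Tip"
  proof (rule ccontr)
    assume "c \<noteq> Tip"
    then obtain y where y: "y \<in> tverts c" "(w, y) \<in> join w c" using join_nonempty[of c w] by blast
    then have "b \<in> ?E `` {w}" "y \<in> ?E `` {w}" using t(3)[symmetric] by auto
    then have "b = y" using w(2) by simp
    then show False using y t(1) by auto
  qed
  let ?t = "Node w b Tip d e"
  note t = t[unfolded \<open>c = Tip\<close>]
  have size: "tsize ?t = \<alpha>" using card_tverts[OF t(1), unfolded t(2) n] by (simp only: mult_cancel_left) simp
  have num: "num_max_independent_sets T = tcount ?t"
    using num_max_independent_sets_ptree[OF pg t(1)] t(2,3) size assms(4) by metis
  have le: "num_max_independent_sets T \<le> fib (\<alpha> + 2)"
    using tcount_bound[OF t(1)] num size by metis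
  have "num_max_independent_sets T = fib (\<alpha> + 2) \<longleftrightarrow> (\<exists>L. length L = \<alpha> \<and> is_comb ?V ?E L)"
  proof
    assume "num_max_independent_sets T = fib (\<alpha> + 2)"
    then obtain L M where "d = chain L" "e = chain M"
      using tcount_eq_imp_chain[OF t(1)] num size by metis
    then have "is_comb ?V ?E (rev L @ (b, w) # M)" "length (rev L @ (b, w) # M) = \<alpha>"
      using is_comb_two_chains[of w b L M] t size by auto
    then show "\<exists>L. length L = \<alpha> \<and> is_comb ?V ?E L" by blast
  next
    assume "\<exists>L. length L = \<alpha> \<and> is_comb ?V ?E L"
    then obtain L where L: "length L = \<alpha>" "is_comb ?V ?E L" by blast
    \<comment> \<open>Rooted at an end of its path, the comb is a chain on the same graph. This
      decomposition may differ from \<open>?t\<close>, but it counts the same sets.\<close>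
    have "wf_ptree (chain L)" "tverts (chain L) = ?V" "tarcs (chain L) = ?E"
      using L(2) wf_ptree_chain[of L] tverts_chain[of L] tarcs_chain[of L] by simp_all
    then have "num_max_independent_sets T = tcount (chain L)"
      using num_max_independent_sets_ptree[OF pg] L(1) assms(4) tsize_chain by metis
    then show "num_max_independent_sets T = fib (\<alpha> + 2)"
      using tcount_chain[OF \<open>wf_ptree (chain L)\<close>] L(1) by simp
  qed
  then show ?thesis using le digraph_iso_T_graph_iff[OF pg] by simp
qed

end
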